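(* Let $M$ be a monoid, $X$ a left zero semigroup (i.e. $xy=x$ for all $x,y\in X$) and $\alpha$ a strong partial action of $M$ on $X$. For $m\in M$ let $[m,X]=\{[m,x]:x\in X\}\subseteq X_M$. Then the rewriting system $(X_M^+,\to)$ associated with $\alpha$ is locally confluent if and only if for all $m,n\in M$ we have $$[m,X]\cap[n,X]\neq\emptyset\ \Rightarrow\ \forall u\in[m,X]\ \forall v\in[n,X]\ \exists k\in M:\ u,v\in[k,X].$$
   Context: Let $M$ be a monoid with identity $e$. A strong partial action of $M$ on a set $X$ is a family $\alpha=\{\alpha_m:\operatorname{dom}\alpha_m\to X\}_{m\in M}$ of maps with $\operatorname{dom}\alpha_m\subseteq X$ such that: (1) $\operatorname{dom}\alpha_e=X$ and $\alpha_e=\mathrm{id}_X$; (2) $\alpha_m^{-1}(\operatorname{dom}\alpha_n)=\operatorname{dom}\alpha_{nm}\cap\operatorname{dom}\alpha_m$ for all $m,n\in M$; (3) $\alpha_n\circ\alpha_m=\alpha_{nm}$ on $\alpha_m^{-1}(\operatorname{dom}\alpha_n)$ for all $m,n\in M$. A strong partial action of $M$ on a semigroup $X$ is one on the underlying set such that each $\operatorname{dom}\alpha_m$ is a (possibly empty) subsemigroup of $X$ and each $\alpha_m$ is a semigroup homomorphism. $X_M=(M\times X)/{\approx}$, where $\approx$ is the equivalence relation generated by: $(m,x)\rightharpoonup(n,y)$ iff there is $k\in M$ with $m=nk$, $x\in\operatorname{dom}\alpha_k$ and $y=\alpha_k(x)$. The class of $(m,x)$ is $[m,x]$. $X_M^+$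 is the free semigroup on $X_M$ (nonempty words), $X_M^*$ the free monoid. The relation $\to$ on $X_M^+$ is: $u[m,x][m,y]v\to u[m,xy]v$ for all $u,v\in X_M^*$, $m\in M$, $x,y\in X$. $\overset{*}{\to}$ is the reflexive transitive closure of $\to$. A word $w$ is locally confluent if whenever $w\to w_1$ and $w\to w_2$ there is $w'$ with $w_1\overset{*}{\to}w'$ and $w_2\overset{*}{\to}w'$; $(X_M^+,\to)$ is locally confluent if every word is. *)

theory Defs
  imports Main
begin

text \<open>
  The constant glob stands for the globalization X_M, cls \<alpha> m x for its element [m, x], and
  words \<alpha> for the free semigroup on X_M. As X is a type, it is nonempty; the domains of the partial
  maps may be empty, and they are all of X for the identity by act_one.
\<close>

locale strong_partial_action =
  fixes \<alpha> :: "'m::monoid_mult \<Rightarrow> 'x \<Rightarrow> 'x option"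
  assumes act_one: "\<alpha> 1 = Some"
    and act_dom: "{x \<in> dom (\<alpha> m). the (\<alpha> m x) \<in> dom (\<alpha> n)} = dom (\<alpha> (n * m)) \<inter> dom (\<alpha> m)"
    and act_comp: "x \<in> {x \<in> dom (\<alpha> m). the (\<alpha> m x) \<in> dom (\<alpha> n)} \<Longrightarrow>
      \<alpha> n (the (\<alpha> m x)) = \<alpha> (n * m) x"

locale semigroup_strong_partial_action = strong_partial_action \<alpha>
  for \<alpha> :: "'m::monoid_mult \<Rightarrow> 'x::semigroup_mult \<Rightarrow> 'x option" +
  assumes dom_mult: "x \<in> dom (\<alpha> m) \<Longrightarrow> y \<in> dom (\<alpha> m) \<Longrightarrow> x * y \<in> dom (\<alpha> m)"
    and act_mult: "x \<in> dom (\<alpha> m) \<Longrightarrow> y \<in> dom (\<alpha> m) \<Longrightarrow>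
      the (\<alpha> m (x * y)) = the (\<alpha> m x) * the (\<alpha> m y)"

definition glob_step :: "('m::monoid_mult \<Rightarrow> 'x \<Rightarrow> 'x option) \<Rightarrow> 'm \<times> 'x \<Rightarrow> 'm \<times> 'x \<Rightarrow> bool" where
  "glob_step \<alpha> p q \<longleftrightarrow>
    (\<exists>k. fst p = fst q * k \<and> snd p \<in> dom (\<alpha> k) \<and> snd q = the (\<alpha> k (snd p)))"

definition glob_rel :: "('m::monoid_mult \<Rightarrow> 'x \<Rightarrow> 'x option) \<Rightarrow> (('m \<times> 'x) \<times> ('m \<times> 'x)) set" where
  "glob_rel \<alpha> = {(p, q). equivclp (glob_step \<alpha>) p q}"

definition glob :: "('m::monoid_mult \<Rightarrow> 'x \<Rightarrow> 'x option) \<Rightarrow> ('m \<times> 'x) set set" where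
  "glob \<alpha> = UNIV // glob_rel \<alpha>"

definition cls :: "('m::monoid_mult \<Rightarrow> 'x \<Rightarrow> 'x option) \<Rightarrow> 'm \<Rightarrow> 'x \<Rightarrow> ('m \<times> 'x) set" where
  "cls \<alpha> m x = glob_rel \<alpha> `` {(m, x)}"

definition words :: "('m::monoid_mult \<Rightarrow> 'x \<Rightarrow> 'x option) \<Rightarrow> ('m \<times> 'x) set list set" where
  "words \<alpha> = lists (glob \<alpha>) - {[]}"

inductive rewr :: "('m::monoid_mult \<Rightarrow> 'x::semigroup_mult \<Rightarrow> 'x option) \<Rightarrow>
    ('m \<times> 'x) set list \<Rightarrow> ('m \<times> 'x) set list \<Rightarrow> bool"
  for \<alpha> where
  "u \<in> lists (glob \<alpha>) \<Longrightarrow> v \<in> lists (glob \<alpha>) \<Longrightarrow>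
    rewr \<alpha> (u @ [cls \<alpha> m x, cls \<alpha> m y] @ v) (u @ [cls \<alpha> m (x * y)] @ v)"

definition locally_confluent_at :: "('a \<Rightarrow> 'a \<Rightarrow> bool) \<Rightarrow> 'a \<Rightarrow> bool" where
  "locally_confluent_at r w \<longleftrightarrow>
    (\<forall>w1 w2. r w w1 \<and> r w w2 \<longrightarrow> (\<exists>w'. r\<^sup>*\<^sup>* w1 w' \<and> r\<^sup>*\<^sup>* w2 w'))"

definition locally_confluent_on :: "'a set \<Rightarrow> ('a \<Rightarrow> 'a \<Rightarrow> bool) \<Rightarrow> bool" where
  "locally_confluent_on A r \<longleftrightarrow> (\<forall>w\<in>A. locally_confluent_at r w)"

end

theory Submission
  imports Defs
begin

text \<open>
  Call two elements of \<open>X_M\<close> adjacent if they lie in a common set \<open>[k, X]\<close>. Over a left zero semigroup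
  a rewriting step deletes a letter which is adjacent to its left neighbour, and the condition of the
  theorem says that adjacency is transitive. If \<open>a\<close>, \<open>b\<close> and \<open>b\<close>, \<open>c\<close> are adjacent but \<open>a\<close>, \<open>c\<close>
  are not, then \<open>abc\<close> rewrites to the irreducible word \<open>ac\<close> and to \<open>ab\<close>, which does not reduce
  to \<open>ac\<close>. Conversely, the only critical pair comes from such a word \<open>abc\<close>, and under
  transitivity both of its reducts rewrite to \<open>a\<close>.
\<close>

definition adjacent :: "('m::monoid_mult \<Rightarrow> 'x \<Rightarrow> 'x option) \<Rightarrow> ('m \<times> 'x) set \<Rightarrow> ('m \<times> 'x) set \<Rightarrow> bool"
  where "adjacent \<alpha> a b \<longleftrightarrow> (\<exists>k. a \<in> range (cls \<alpha> k) \<and> b \<in> range (cls \<alpha> k))"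

lemma cls_in_glob: "cls \<alpha> m x \<in> glob \<alpha>"
  by (auto simp: cls_def glob_def quotient_def)

lemma adjacent_in_glob:
  assumes "adjacent \<alpha> a b"
  shows "a \<in> glob \<alpha>" "b \<in> glob \<alpha>"
  using assms by (auto simp: adjacent_def cls_in_glob)

context
  fixes \<alpha> :: "'m::monoid_mult \<Rightarrow> 'x::semigroup_mult \<Rightarrow> 'x option"
  assumes left_zero: "\<forall>x y :: 'x. x * y = x"
begin

text \<open>Since \<open>x * y = x\<close>, contracting \<open>[m, x][m, y]\<close> keeps the left
  letter and drops the right one. The index \<open>m\<close> is absorbed into the existential
  quantifier of \<open>adjacent\<close>, so the later arguments need no representatives.\<close>

lemma rewr_left_zero_iff:
  "rewr \<alpha> w w' \<longleftrightarrow> (\<exists>u v a b. u \<in> lists (glob \<alpha>) \<and> v \<in> lists (glob \<alpha>) \<and> adjacent \<alpha> a b \<and>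
    w = u @ a # b # v \<and> w' = u @ a # v)" (is "_ \<longleftrightarrow> ?R")
proof
  assume "rewr \<alpha> w w'"
  then show ?R
  proof cases
    case (1 u v m x y)
    moreover have "adjacent \<alpha> (cls \<alpha> m x) (cls \<alpha> m y)"
      by (auto simp: adjacent_def)
    ultimately show ?thesis
      using left_zero by auto
  qed
next
  assume ?R
  then obtain u v a b k x y where *: "u \<in> lists (glob \<alpha>)" "v \<in> lists (glob \<alpha>)"
    and ab: "a = cls \<alpha> k x" "b = cls \<alpha> k y" and w: "w = u @ a # b # v" "w' = u @ a # v"
    unfolding adjacent_def by blast
  from rewr.intros[OF *, of k x y] show "rewr \<alpha> w w'"
    using left_zero ab w by simp
qed

lemma rewr_left_zeroI:
  assumes "u \<in> lists (glob \<alpha>)" "v \<in> lists (glob \<alpha>)" "adjacent \<alpha> a b"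
  shows "rewr \<alpha> (u @ a # b # v) (u @ a # v)"
  using assms rewr_left_zero_iff by blast

lemma rewr_left_zero_pairD:
  assumes "rewr \<alpha> [a, b] w"
  shows "adjacent \<alpha> a b" "w = [a]"
proof -
  from assms obtain u v c d where "adjacent \<alpha> c d" "[a, b] = u @ c # d # v" "w = u @ c # v"
    unfolding rewr_left_zero_iff by blast
  then show "adjacent \<alpha> a b" "w = [a]"
    by (cases u; auto)+
qed

lemma not_rewr_singleton: "\<not> rewr \<alpha> [a] w"
  by (auto simp: rewr_left_zero_iff Cons_eq_append_conv)

text \<open>A two-letter word has a single factor of length two, and a one-letter word is
  irreducible. Hence at most one step is possible, and it requires the two letters to be
  adjacent.\<close>

lemma rtranclp_rewr_pairD:
  assumes "(rewr \<alpha>)\<^sup>*\<^sup>* [a, b] w"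
  shows "w = [a, b] \<or> w = [a] \<and> adjacent \<alpha> a b"
  using assms
proof (induction rule: rtranclp_induct)
  case (step y z)
  then show ?case
    using rewr_left_zero_pairD[of a b z] not_rewr_singleton by blast
qed simp

lemma transp_adjacent_if_locally_confluent:
  assumes lc: "locally_confluent_on (words \<alpha>) (rewr \<alpha>)"
  shows "transp (adjacent \<alpha>)"
proof (rule transpI)
  fix a b c
  assume ab: "adjacent \<alpha> a b" and bc: "adjacent \<alpha> b c"
  have glob: "a \<in> glob \<alpha>" "b \<in> glob \<alpha>" "c \<in> glob \<alpha>"
    using adjacent_in_glob[OF ab] adjacent_in_glob[OF bc] by auto
  have "rewr \<alpha> [a, b, c] [a, c]"
    using rewr_left_zeroI[of "[]" "[c]" a b] glob ab by simp
  moreover have "rewr \<alpha> [a, b, c] [a, b]"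
    using rewr_left_zeroI[of "[a]" "[]" b c] glob bc by simp
  moreover have "[a, b, c] \<in> words \<alpha>"
    using glob by (simp add: words_def)
  ultimately obtain w where "(rewr \<alpha>)\<^sup>*\<^sup>* [a, c] w" "(rewr \<alpha>)\<^sup>*\<^sup>* [a, b] w"
    using lc unfolding locally_confluent_on_def locally_confluent_at_def by blast
  \<comment> \<open>If \<open>a\<close> and \<open>c\<close> were not adjacent, \<open>w\<close>
    would be \<open>[a, c]\<close>. As a reduct of \<open>[a, b]\<close> it would have to equal
    \<open>[a, b]\<close>, so \<open>c = b\<close>, and then \<open>ab\<close> gives the adjacency
    after all.\<close>
  then show "adjacent \<alpha> a c"
    using rtranclp_rewr_pairD[of a c w] rtranclp_rewr_pairD[of a b w] ab by auto
qed

text \<open>The word \<open>t\<close> is the offset from the first redex to the second. The redexes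
  coincide, overlap in one letter or are disjoint, according to the length of
  \<open>t\<close>.\<close>

lemma joinable_if_transp_adjacent:
  assumes trans: "transp (adjacent \<alpha>)"
    and lists: "u \<in> lists (glob \<alpha>)" "v \<in> lists (glob \<alpha>)" "t \<in> lists (glob \<alpha>)" "v' \<in> lists (glob \<alpha>)"
    and ab: "adjacent \<alpha> a b" and cd: "adjacent \<alpha> c d"
    and eq: "a # b # v = t @ c # d # v'"
  shows "\<exists>w. (rewr \<alpha>)\<^sup>*\<^sup>* (u @ a # v) w \<and> (rewr \<alpha>)\<^sup>*\<^sup>* (u @ t @ c # v') w"
proof -
  note glob = adjacent_in_glob[OF ab] adjacent_in_glob[OF cd]
  consider "t = []" | "t = [a]" | s where "t = a # b # s"
    using eq by (cases t; cases "tl t") auto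
  then show ?thesis
  proof cases
    case 1
    then show ?thesis using eq by auto
  next
    \<comment> \<open>The critical pair: the reducts contain \<open>a d\<close> and
      \<open>a b\<close> in place of \<open>a b d\<close>. Transitivity makes \<open>a\<close> and
      \<open>d\<close> adjacent, so \<open>d\<close> can be deleted even after \<open>b\<close> is
      gone.\<close>
    case 2
    then have v: "b = c" "v = d # v'"
      using eq by auto
    have "rewr \<alpha> (u @ a # v) (u @ a # v')"
      using rewr_left_zeroI[of u v' a d] transpD[OF trans ab] cd lists v by simp
    moreover have "rewr \<alpha> (u @ t @ c # v') (u @ a # v')"
      using rewr_left_zeroI[of u v' a b] ab lists 2 v by simp
    ultimately show ?thesis by blast
  next
    \<comment> \<open>Disjoint redexes: the two deletions commute.\<close>
    case (3 s)
    then have v: "v = s @ c # d # v'"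
      using eq by auto
    have "rewr \<alpha> (u @ a # v) (u @ a # s @ c # v')"
      using rewr_left_zeroI[of "u @ a # s" v' c d] cd lists glob 3 v by simp
    moreover have "rewr \<alpha> (u @ t @ c # v') (u @ a # s @ c # v')"
      using rewr_left_zeroI[of u "s @ c # v'" a b] ab lists glob 3 by simp
    ultimately show ?thesis by blast
  qed
qed

lemma locally_confluent_if_transp_adjacent:
  assumes trans: "transp (adjacent \<alpha>)"
  shows "locally_confluent_on A (rewr \<alpha>)"
  unfolding locally_confluent_on_def locally_confluent_at_def
proof (intro ballI allI impI, elim conjE)
  fix w w1 w2
  assume "rewr \<alpha> w w1" "rewr \<alpha> w w2"
  then obtain u v a b u' v' c d where
    *: "u \<in> lists (glob \<alpha>)" "v \<in> lists (glob \<alpha>)" "adjacent \<alpha> a b" "w = u @ a # b # v" "w1 = u @ a # v" and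
    **: "u' \<in> lists (glob \<alpha>)" "v' \<in> lists (glob \<alpha>)" "adjacent \<alpha> c d" "w = u' @ c # d # v'" "w2 = u' @ c # v'"
    unfolding rewr_left_zero_iff by blast
  from *(4) **(4) have "u @ a # b # v = u' @ c # d # v'"
    by simp
  \<comment> \<open>Either redex may be the left one; the second case is the first with the two
    steps exchanged.\<close>
  then consider t where "u' = u @ t" "a # b # v = t @ c # d # v'"
    | t where "u = u' @ t" "c # d # v' = t @ a # b # v"
    by (auto simp: append_eq_append_conv2)
  then show "\<exists>w'. (rewr \<alpha>)\<^sup>*\<^sup>* w1 w' \<and> (rewr \<alpha>)\<^sup>*\<^sup>* w2 w'"
  proof cases
    case (1 t)
    then show ?thesis
      using joinable_if_transp_adjacent[OF trans, of u v t v' a b c d] * ** by simp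
  next
    case (2 t)
    then show ?thesis
      using joinable_if_transp_adjacent[OF trans, of u' v' t v c d a b] * ** by auto
  qed
qed

end

theorem proposition4p15:
  fixes \<alpha> :: "'m::monoid_mult \<Rightarrow> 'x::semigroup_mult \<Rightarrow> 'x option"
  assumes left_zero: "\<forall>x y :: 'x. x * y = x"
    and action: "semigroup_strong_partial_action \<alpha>"
  shows "locally_confluent_on (words \<alpha>) (rewr \<alpha>) \<longleftrightarrow>
    (\<forall>m n. range (cls \<alpha> m) \<inter> range (cls \<alpha> n) \<noteq> {} \<longrightarrow>
      (\<forall>u \<in> range (cls \<alpha> m). \<forall>v \<in> range (cls \<alpha> n).
        \<exists>k. u \<in> range (cls \<alpha> k) \<and> v \<in> range (cls \<alpha> k)))"
    (is "_ \<longleftrightarrow> ?C")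
proof -
  \<comment> \<open>A common element of \<open>[m, X]\<close> and \<open>[n, X]\<close> is exactly a
    middle term linking each \<open>u\<close> in \<open>[m, X]\<close> to each \<open>v\<close> in
    \<open>[n, X]\<close>.\<close>
  have "?C \<longleftrightarrow> transp (adjacent \<alpha>)"
  proof
    assume ?C
    show "transp (adjacent \<alpha>)"
    proof (rule transpI)
      fix a b c
      assume "adjacent \<alpha> a b" "adjacent \<alpha> b c"
      then obtain m n where "a \<in> range (cls \<alpha> m)" "b \<in> range (cls \<alpha> m) \<inter> range (cls \<alpha> n)"
        "c \<in> range (cls \<alpha> n)"
        unfolding adjacent_def by blast
      with \<open>?C\<close> show "adjacent \<alpha> a c"
        unfolding adjacent_def by (metis empty_iff)
    qed
  next
    assume trans: "transp (adjacent \<alpha>)"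
    have "adjacent \<alpha> u v"
      if "w \<in> range (cls \<alpha> m)" "w \<in> range (cls \<alpha> n)" "u \<in> range (cls \<alpha> m)" "v \<in> range (cls \<alpha> n)"
      for u v w m n
      using transpD[OF trans, of u w v] that unfolding adjacent_def by metis
    then show ?C
      unfolding adjacent_def[symmetric] by (metis disjoint_iff)
  qed
  moreover have "locally_confluent_on (words \<alpha>) (rewr \<alpha>) \<longleftrightarrow> transp (adjacent \<alpha>)"
    using transp_adjacent_if_locally_confluent[OF left_zero]
      locally_confluent_if_transp_adjacent[OF left_zero] by (rule iffI)
  ultimately show ?thesis
    by (rule trans[rotated, OF sym])
qed

end
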